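(* Let ${\bf B}$ be Kimberling's infinite binary word, with positions indexed starting at $1$. For $n\ge 1$ let $I_0(n)$ (respectively $I_1(n)$) be the position of the $n$'th occurrence of the letter $0$ (respectively $1$) in ${\bf B}$. Let $\psi=1.8392867552\cdots$ be the unique real zero of $X^3-X^2-X-1$, and let $\gamma=(\psi^2+1)/2=2.19148788\cdots$. Then for all $n\ge 1$ we have (a) $\lfloor \psi n\rfloor-2\le I_0(n)\le \lfloor \psi n\rfloor+2$; (b) $\lfloor \gamma n\rfloor-1\le I_1(n)\le \lfloor \gamma n\rfloor+3$.
   Context: Definition of ${\bf B}$: Let $B_0=00$. Given a binary word $B_i$, factor it into blocks: each letter $1$ is a block by itself, and each maximal run of consecutive $0$'s is a block, which is either $0$ or $00$ (runs of three or more $0$'s never occur). Then $B_{i+1}$ is obtained by replacing each block $0$ by $0$, each block $1$ by $10$, and each block $00$ by $0101$. For example $B_1=0101$, $B_2=010010$, $B_3=0100101100$. For $i\ge 2$, $B_i$ is a prefix of $B_{i+1}$, and ${\bf B}=0100101100\cdots$ is the unique infinite word having all $B_i$, $i\ge 2$, as prefixes. With indexing from $1$, the first letter of ${\bf B}$ is at position $1$, so e.g. $I_0(1)=1$, $I_1(1)=2$. *)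

theory Defs
  imports Complex_Main "HOL-Library.Stream" "HOL-Library.Infinite_Set"
begin

datatype letter = Zero | One

function blocks :: "letter list \<Rightarrow> letter list list" where
  "blocks [] = []"
| "blocks (One # w) = [One] # blocks w"
| "blocks (Zero # w) =
     (Zero # takeWhile (\<lambda>a. a = Zero) w) # blocks (dropWhile (\<lambda>a. a = Zero) w)"
  by pat_completeness auto
termination
  by (relation "measure length") (auto simp: less_Suc_eq_le length_dropWhile_le)

text \<open>
  Runs of three or more letters \<open>Zero\<close> never occur in the words below, so nothing
  is specified about the image of such a block.
\<close>

definition block_image :: "letter list \<Rightarrow> letter list" where
  "block_image b =
     (if b = [Zero] then [Zero]
      else if b = [One] then [One, Zero]
      else if b = [Zero, Zero] then [Zero, One, Zero, One]
      else undefined)"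

fun B_word :: "nat \<Rightarrow> letter list" where
  "B_word 0 = [Zero, Zero]"
| "B_word (Suc i) = concat (map block_image (blocks (B_word i)))"

definition B_inf :: "letter stream" where
  "B_inf = (THE s. \<forall>i\<ge>2. stake (length (B_word i)) s = B_word i)"

text \<open>
  Streams are indexed from 0, whereas positions in the infinite word are counted from 1.
\<close>

definition positions :: "letter \<Rightarrow> nat set" where
  "positions a = {p. p \<ge> 1 \<and> B_inf !! (p - 1) = a}"

text \<open>
  \<open>occ_pos a n\<close> is the position of the \<open>n\<close>-th occurrence of \<open>a\<close>, for \<open>n \<ge> 1\<close>;
  \<^const>\<open>enumerate\<close> counts from 0.
\<close>

definition occ_pos :: "letter \<Rightarrow> nat \<Rightarrow> nat" where
  "occ_pos a n = enumerate (positions a) (n - 1)"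

abbreviation I0 :: "nat \<Rightarrow> nat" where "I0 \<equiv> occ_pos Zero"
abbreviation I1 :: "nat \<Rightarrow> nat" where "I1 \<equiv> occ_pos One"

definition psi :: real where
  "psi = (THE x. x ^ 3 - x ^ 2 - x - 1 = 0)"

definition gamma :: real where
  "gamma = (psi ^ 2 + 1) / 2"

end

theory Submission
  imports Defs "HOL-Library.Sublist"
begin

text \<open>
  Cut a word before each \<open>One\<close>.  On the factors \<open>1\<close>, \<open>10\<close>, \<open>100\<close> the block substitution is the
  morphism \<open>1 \<mapsto> 10 \<mapsto> 100 \<mapsto> 100 10 1\<close>, so its iterates \<open>T\<^sub>n\<close> on \<open>1\<close> satisfy
  \<open>T\<^sub>n\<^sub>+\<^sub>3 = T\<^sub>n\<^sub>+\<^sub>2 T\<^sub>n\<^sub>+\<^sub>1 T\<^sub>n\<close>, and \<open>\<^bold>B = 0 \<cdot> lim T\<^sub>n\<close>.  Let \<open>disc w = |w| - psi |w|\<^sub>0\<close>.  As \<open>psi\<close> is a Pisot number,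
  \<open>disc T\<^sub>n\<close> tends to \<open>0\<close> geometrically.  A prefix of \<open>T\<^sub>n\<^sub>+\<^sub>3\<close> is one of \<open>T\<^sub>n\<^sub>+\<^sub>2\<close>, \<open>T\<^sub>n\<^sub>+\<^sub>1\<close> or \<open>T\<^sub>n\<close>
  shifted by a few of these small quantities, so \<open>disc\<close> is bounded on prefixes of \<open>\<^bold>B\<close>: it stays
  between \<open>-2.5\<close> and \<open>1.65\<close>.  For a prefix of length \<open>p\<close> with \<open>n\<close> zeros \<open>disc\<close> is \<open>p - psi n\<close>, and
  for one with \<open>n\<close> ones it is \<open>-(psi - 1) (p - gamma n)\<close>, because \<open>gamma = psi / (psi - 1)\<close>.
\<close>

section \<open>The number \<open>psi\<close>\<close>

lemma psi_root: "psi ^ 3 - psi ^ 2 - psi - 1 = 0"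
  and psi_gt: "1839286 / 1000000 < psi"
  and psi_lt: "psi < 1839287 / 1000000"
proof -
  let ?f = "\<lambda>x::real. x ^ 3 - x ^ 2 - x - 1"
  have "\<exists>x\<ge>1839286 / 1000000. x \<le> 1839287 / 1000000 \<and> ?f x = 0"
    by (rule IVT) (auto simp: power2_eq_square power3_eq_cube intro!: continuous_intros)
  then obtain x where x: "1839286 / 1000000 \<le> x" "x \<le> 1839287 / 1000000" "?f x = 0"
    by blast
  have uniq: "y = x" if "?f y = 0" for y
  proof (rule ccontr)
    assume "y \<noteq> x"
    have "(y - x) * (y\<^sup>2 + y * (x - 1) + (x\<^sup>2 - x - 1)) = ?f y - ?f x"
      by (simp add: algebra_simps power2_eq_square power3_eq_cube)
    with that x \<open>y \<noteq> x\<close> have "y\<^sup>2 + y * (x - 1) + (x\<^sup>2 - x - 1) = 0"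
      by simp
    \<comment> \<open>Completing the square: the cofactor of \<open>y - x\<close> has no real zero,
      because \<open>x * (3 * x - 2)\<close> exceeds 5.\<close>
    moreover have "y\<^sup>2 + y * (x - 1) + (x\<^sup>2 - x - 1) = (y + (x - 1) / 2)\<^sup>2 + (x * (3 * x - 2) - 5) / 4"
      by (simp add: field_simps power2_eq_square)
    moreover have "0 < (y + (x - 1) / 2)\<^sup>2 + (x * (3 * x - 2) - 5) / 4"
    proof (rule add_nonneg_pos)
      have "1839286 / 1000000 * (3 * (1839286 / 1000000) - 2) \<le> x * (3 * x - 2)"
        by (rule mult_mono) (use x in auto)
      then show "0 < (x * (3 * x - 2) - 5) / 4" by simp
    qed simp
    ultimately show False by (metis less_irrefl)
  qed
  have psi: "psi = x"
    unfolding psi_def using x(3) uniq by (rule the_equality)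
  show root: "?f psi = 0"
    using psi x by simp
  have "?f (1839286 / 1000000) \<noteq> 0" "?f (1839287 / 1000000) \<noteq> 0"
    by (simp_all add: power_divide)
  then have "x \<noteq> 1839286 / 1000000" "x \<noteq> 1839287 / 1000000"
    using x(3) by blast+
  then show "1839286 / 1000000 < psi" "psi < 1839287 / 1000000"
    using psi x by auto
qed

lemma psi_cube: "psi * psi * psi = psi * psi + psi + 1"
  using psi_root by (simp add: power2_eq_square power3_eq_cube)

lemma psi_square_bounds: "3382972 / 1000000 < psi * psi" "psi * psi < 3382977 / 1000000"
proof -
  have "1839286 / 1000000 * (1839286 / 1000000) < psi * psi"
    by (rule mult_strict_mono) (use psi_gt in auto)
  then show "3382972 / 1000000 < psi * psi" by simp
  have "psi * psi < 1839287 / 1000000 * (1839287 / 1000000)"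
    by (rule mult_strict_mono) (use psi_gt psi_lt in auto)
  then show "psi * psi < 3382977 / 1000000" by simp
qed

lemma gamma_eq: "gamma * (psi - 1) = psi"
  using psi_cube by (simp add: gamma_def field_simps power2_eq_square)

section \<open>The words \<open>T\<^sub>n\<close>\<close>

fun T :: "nat \<Rightarrow> letter list" where
  "T 0 = [One]"
| "T (Suc 0) = [One, Zero]"
| "T (Suc (Suc 0)) = [One, Zero, Zero]"
| "T (Suc (Suc (Suc n))) = T (Suc (Suc n)) @ T (Suc n) @ T n"

lemma T_starts_One: "\<exists>w. T n = One # w"
  by (induction n rule: T.induct) auto

lemma length_T: "n < length (T n)"
proof (induction n rule: T.induct)
  case (4 n)
  moreover obtain w where "T n = One # w"
    using T_starts_One by blast
  ultimately show ?case by simp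
qed auto

lemma count_T_pos: "1 \<le> count_list (T (Suc n)) a"
proof (induction n)
  case 0
  then show ?case by (cases a) auto
next
  case (Suc n)
  then show ?case by (cases n; cases a) auto
qed

lemma count_T_ge: "n \<le> count_list (T (Suc (Suc n))) a"
proof (induction n)
  case (Suc n)
  then show ?case using count_T_pos[of n a] by simp
qed simp

abbreviation block_map :: "letter list \<Rightarrow> letter list" where
  "block_map w \<equiv> concat (map block_image (blocks w))"

text \<open>A \<open>One\<close> ends every run of zeros, so a cut before it never splits a
  block.\<close>

lemma blocks_append_One: "blocks (u @ One # w) = blocks u @ blocks (One # w)"
proof (induction u rule: blocks.induct)
  case (3 u)
  have "takeWhile (\<lambda>a. a = Zero) (u @ One # w) = takeWhile (\<lambda>a. a = Zero) u"
    by (induction u) auto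
  moreover have "dropWhile (\<lambda>a. a = Zero) (u @ One # w) = dropWhile (\<lambda>a. a = Zero) u @ One # w"
    by (induction u) auto
  ultimately show ?case using 3 by simp
qed auto

lemma block_map_append_T: "block_map (u @ T n @ w) = block_map u @ block_map (T n @ w)"
  using T_starts_One[of n] blocks_append_One by fastforce

lemma block_map_append_T': "block_map (u @ T n) = block_map u @ block_map (T n)"
  using block_map_append_T[of u n "[]"] by simp

lemma block_map_T: "block_map (T n) = T (Suc n)"
proof (induction n rule: T.induct)
  case (4 n)
  then show ?case
    by (simp only: T.simps(4) block_map_append_T block_map_append_T')
qed (auto simp: block_image_def)

text \<open>The leading \<open>Zero\<close> is a block by itself, as a \<open>One\<close> follows,
  and is its own image.\<close>

lemma B_word_eq: "B_word (Suc i) = Zero # T (Suc i) @ T i"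
proof (induction i)
  case 0
  then show ?case by (simp add: block_image_def)
next
  case (Suc i)
  have "B_word (Suc (Suc i)) = block_map ([Zero] @ T (Suc i) @ T i)"
    using Suc by simp
  also have "\<dots> = block_map [Zero] @ T (Suc (Suc i)) @ T (Suc i)"
    by (simp only: block_map_append_T block_map_append_T' block_map_T)
  finally show ?case by (simp add: block_image_def)
qed

section \<open>The infinite word\<close>

lemma B_word_prefix: "i \<le> j \<Longrightarrow> prefix (B_word (i + 2)) (B_word (j + 2))"
proof (induction j rule: dec_induct)
  case (step j)
  have "prefix (B_word (j + 2)) (B_word (Suc j + 2))"
    using B_word_eq[of "Suc j"] B_word_eq[of "Suc (Suc j)"] by simp
  with step show ?case
    using prefix_order.trans by blast
qed simp

lemma length_B_word: "i < length (B_word (i + 2))"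
  using B_word_eq[of "Suc i"] length_T[of "Suc i"] by simp

lemma B_inf_unique_ex: "\<exists>!s. \<forall>i\<ge>2. stake (length (B_word i)) s = B_word i"
proof (rule ex_ex1I)
  \<comment> \<open>\<open>length_B_word\<close> keeps the index \<open>k\<close> in range; by
    \<open>B_word_prefix\<close> the choice of word is immaterial.\<close>
  define s where "s = smap (\<lambda>k. B_word (k + 2) ! k) nats"
  have "stake (length (B_word (i + 2))) s = B_word (i + 2)" for i
  proof (rule nth_equalityI)
    fix k assume "k < length (stake (length (B_word (i + 2))) s)"
    then have k: "k < length (B_word (i + 2))" by simp
    have "B_word (k + 2) ! k = B_word (i + 2) ! k"
      using B_word_prefix[of i k] B_word_prefix[of k i] length_B_word[of k] k
      by (metis nat_le_linear prefix_def nth_append)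
    with k show "stake (length (B_word (i + 2))) s ! k = B_word (i + 2) ! k"
      by (simp add: s_def)
  qed simp
  then have "\<forall>i\<ge>2. stake (length (B_word i)) s = B_word i"
    by (metis le_add_diff_inverse2)
  then show "\<exists>s. \<forall>i\<ge>2. stake (length (B_word i)) s = B_word i" by blast
next
  fix s t
  assume s: "\<forall>i\<ge>2. stake (length (B_word i)) s = B_word i"
    and t: "\<forall>i\<ge>2. stake (length (B_word i)) t = B_word i"
  have "s !! k = t !! k" for k
    using s t length_B_word[of k] by (metis le_add2 stake_nth)
  then have "smap ((!!) s) nats = smap ((!!) t) nats" by presburger
  then show "s = t" by (simp add: stream_smap_nats[symmetric])
qed

lemma stake_B_inf: "stake (length (B_word (i + 2))) B_inf = B_word (i + 2)"
  using theI'[OF B_inf_unique_ex] unfolding B_inf_def[symmetric] by (simp del: B_word.simps)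

lemma stake_B_inf_prefix:
  obtains u n where "stake (Suc p) B_inf = Zero # u" "prefix u (T (n + 3))"
proof -
  let ?L = "length (B_word (p + 2))"
  have "stake (Suc p) B_inf = take (Suc p) (stake ?L B_inf)"
    using length_B_word[of p] by (simp add: take_stake min_def)
  also have "\<dots> = Zero # take p (T (p + 2) @ T (p + 1))"
    using stake_B_inf[of p] B_word_eq[of "p + 1"] by simp
  finally have "stake (Suc p) B_inf = Zero # take p (T (p + 2) @ T (p + 1))" .
  moreover have "prefix (take p (T (p + 2) @ T (p + 1))) (T (p + 3))"
  proof (rule prefix_order.trans[OF take_is_prefix])
    show "prefix (T (p + 2) @ T (p + 1)) (T (p + 3))"
      by (simp add: numeral_eq_Suc)
  qed
  ultimately show ?thesis using that by blast
qed

lemma count_stake: "count_list (stake p B_inf) a = card {q \<in> positions a. q \<le> p}"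
proof (induction p)
  case 0
  have "{q \<in> positions a. q \<le> 0} = {}" by (auto simp: positions_def)
  then show ?case by (simp del: le_zero_eq)
next
  case (Suc p)
  have fin: "finite {q \<in> positions a. q \<le> p}" by simp
  have "{q \<in> positions a. q \<le> Suc p} =
      (if B_inf !! p = a then insert (Suc p) {q \<in> positions a. q \<le> p} else {q \<in> positions a. q \<le> p})"
    by (auto simp: positions_def le_Suc_eq)
  then show ?case using Suc fin by (simp add: stake_Suc del: stake.simps)
qed

lemma infinite_positions: "infinite (positions a)"
proof
  assume fin: "finite (positions a)"
  define n where "n = Suc (card (positions a))"
  have "n \<le> count_list (T (n + 2)) a"
    using count_T_ge[of n a] by simp
  also have "\<dots> \<le> count_list (B_word (n + 2)) a"
    using B_word_eq[of "Suc n"] by simp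
  also have "\<dots> = card {q \<in> positions a. q \<le> length (B_word (n + 2))}"
    using count_stake[of "length (B_word (n + 2))" a] stake_B_inf[of n] by simp
  also have "\<dots> \<le> card (positions a)"
    by (rule card_mono) (use fin in auto)
  finally show False by (simp add: n_def)
qed

lemma card_le_enumerate:
  fixes S :: "nat set"
  assumes "infinite S"
  shows "card {q \<in> S. q \<le> enumerate S k} = Suc k"
proof -
  have "{q \<in> S. q \<le> enumerate S k} = enumerate S ` {..k}"
  proof (intro equalityI subsetI)
    fix q assume q: "q \<in> {q \<in> S. q \<le> enumerate S k}"
    then obtain j where "enumerate S j = q"
      using enumerate_Ex[OF assms] by blast
    with q assms show "q \<in> enumerate S ` {..k}"
      by auto
  qed (use assms enumerate_in_set in auto)
  then show ?thesis
    by (simp add: card_image inj_on_subset[OF inj_enumerate[OF assms]])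
qed

lemma count_stake_occ_pos: "1 \<le> n \<Longrightarrow> count_list (stake (occ_pos a n) B_inf) a = n"
  using card_le_enumerate[OF infinite_positions, of a "n - 1"]
  by (simp add: count_stake occ_pos_def)

lemma occ_pos_pos: "1 \<le> occ_pos a n"
  using enumerate_in_set[OF infinite_positions, of a "n - 1"]
  by (simp add: occ_pos_def positions_def)

section \<open>Discrepancy\<close>

definition disc :: "letter list \<Rightarrow> real" where
  "disc w = (\<Sum>a\<leftarrow>w. case a of Zero \<Rightarrow> 1 - psi | One \<Rightarrow> 1)"

lemma disc_Nil [simp]: "disc [] = 0"
  and disc_Zero [simp]: "disc (Zero # w) = (1 - psi) + disc w"
  and disc_One [simp]: "disc (One # w) = 1 + disc w"
  and disc_append [simp]: "disc (u @ w) = disc u + disc w"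
  by (simp_all add: disc_def)

lemma disc_eq_count: "disc w = real (length w) - psi * real (count_list w Zero)"
proof (induction w)
  case (Cons a w)
  then show ?case by (cases a) (simp_all add: algebra_simps)
qed simp

lemma length_eq_count: "length w = count_list w Zero + count_list w One"
proof (induction w)
  case (Cons a w)
  then show ?case by (cases a) simp_all
qed simp

text \<open>
  The three-term recurrence of \<open>disc (T n)\<close> loses its root \<open>psi\<close>: only the two contracting roots,
  those of \<open>X\<^sup>2 + (psi - 1) X + 1 / psi\<close>, contribute.  Note \<open>1 / psi = psi\<^sup>2 - psi - 1\<close>.
\<close>

lemma disc_T_rec2:
  "disc (T (Suc (Suc n))) = (1 - psi) * disc (T (Suc n)) - (psi * psi - psi - 1) * disc (T n)"
proof (induction n)
  case 0
  show ?case using psi_cube by (simp add: algebra_simps)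
next
  case (Suc n)
  let ?x = "disc (T n)" and ?y = "disc (T (Suc n))" and ?z = "disc (T (Suc (Suc n)))"
  \<comment> \<open>The factor \<open>psi\<close> turns the coefficient
    \<open>psi * psi - psi - 1\<close> into 1.\<close>
  have "psi * ?z = psi * ((1 - psi) * ?y - (psi * psi - psi - 1) * ?x)"
    using Suc by simp
  also have "\<dots> = (psi - psi * psi) * ?y - (psi * psi * psi - psi * psi - psi) * ?x"
    by (simp add: algebra_simps)
  also have "psi * psi * psi - psi * psi - psi = 1"
    using psi_cube by simp
  finally show ?case by (simp add: algebra_simps)
qed

text \<open>Four steps ahead both coefficients are small, whereas those of
  \<open>disc_T_rec2\<close> have absolute values with sum above 1.\<close>

lemma disc_T_rec4:
  "disc (T (n + 4)) = (4 - 2 * psi) * disc (T (n + 1)) + (3 + 2 * psi - 2 * (psi * psi)) * disc (T n)"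
proof -
  have "disc (T (n + 4)) = 2 * disc (T (Suc (Suc n))) + 2 * disc (T (Suc n)) + disc (T n)"
    by (simp add: numeral_eq_Suc)
  then show ?thesis
    unfolding disc_T_rec2 by (simp add: algebra_simps)
qed

text \<open>
  The weights make \<open>tail_bound n\<close> an upper bound for \<open>\<Sum>k\<ge>n. \<bar>disc (T k)\<bar>\<close>, in the telescoped form
  of \<open>tail_bound_Suc\<close>: with coefficients \<open>x\<close>, \<open>y\<close> in \<open>\<bar>d\<^sub>k\<^sub>+\<^sub>4\<bar> \<le> y * \<bar>d\<^sub>k\<^sub>+\<^sub>1\<bar> + x * \<bar>d\<^sub>k\<bar>\<close>, what
  is needed is \<open>1 + 1.7 x \<le> 1.15\<close> and \<open>1.15 + 1.7 y \<le> 1.7\<close>.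
\<close>

definition tail_bound :: "nat \<Rightarrow> real" where
  "tail_bound n = 115 / 100 * \<bar>disc (T n)\<bar> +
     17 / 10 * (\<bar>disc (T (n + 1))\<bar> + \<bar>disc (T (n + 2))\<bar> + \<bar>disc (T (n + 3))\<bar>)"

lemma tail_bound_nonneg: "0 \<le> tail_bound n"
  by (simp add: tail_bound_def)

lemma tail_bound_Suc: "tail_bound (Suc n) + \<bar>disc (T n)\<bar> \<le> tail_bound n"
proof -
  let ?x = "\<bar>disc (T n)\<bar>" and ?y = "\<bar>disc (T (n + 1))\<bar>"
  have "\<bar>disc (T (n + 4))\<bar> \<le> \<bar>4 - 2 * psi\<bar> * ?y + \<bar>3 + 2 * psi - 2 * (psi * psi)\<bar> * ?x"
    unfolding disc_T_rec4 abs_mult[symmetric] by (rule abs_triangle_ineq)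
  \<comment> \<open>0.55 / 1.7 and 0.15 / 1.7, rounded down; the actual values are about 0.3214 and
    0.0874.\<close>
  also have "\<dots> \<le> 3235 / 10000 * ?y + 882 / 10000 * ?x"
    by (intro add_mono mult_right_mono) (use psi_gt psi_lt psi_square_bounds in \<open>auto simp: abs_le_iff\<close>)
  finally have "tail_bound (n + 1) + \<bar>disc (T n)\<bar> \<le> tail_bound n"
    using abs_ge_zero[of "disc (T n)"] abs_ge_zero[of "disc (T (n + 1))"]
    by (simp add: tail_bound_def eval_nat_numeral field_simps del: T.simps)
  then show ?thesis by simp
qed

lemma tail_bound_Suc_le: "tail_bound (Suc n) \<le> tail_bound n"
  using tail_bound_Suc[of n] abs_ge_zero[of "disc (T n)"] by linarith

text \<open>A finite check on 20 letters. As \<open>T 3\<close> and \<open>T 4\<close> are prefixes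
  of \<open>T 5\<close>, it serves three base cases at once.\<close>

lemma disc_prefix_T5: "prefix p (T 5) \<Longrightarrow> \<bar>disc p - 2 / 5\<bar> \<le> 112 / 100"
  using psi_gt psi_lt by (auto simp: numeral_eq_Suc prefix_Cons abs_le_iff)

lemma tail_bound_4: "tail_bound 4 \<le> 9 / 10"
  using psi_gt psi_lt by (simp add: tail_bound_def numeral_eq_Suc abs_if, argo)

text \<open>
  \<open>2 / 5\<close> is close to the midpoint of the range of \<open>disc\<close> on these prefixes.
\<close>

lemma disc_prefix_T: "prefix p (T (n + 3)) \<Longrightarrow> \<bar>disc p - 2 / 5\<bar> \<le> 41 / 20 - tail_bound (n + 4)"
proof (induction n arbitrary: p rule: T.induct)
  case 1
  have "prefix (T (0 + 3)) (T 5)" by (simp add: numeral_eq_Suc)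
  with 1 have "prefix p (T 5)" by (rule prefix_order.trans)
  from disc_prefix_T5[OF this] tail_bound_4 show ?case by simp
next
  case 2
  have "prefix (T (Suc 0 + 3)) (T 5)" by (simp add: numeral_eq_Suc)
  with 2 have "prefix p (T 5)" by (rule prefix_order.trans)
  from disc_prefix_T5[OF this] tail_bound_4 tail_bound_Suc_le[of 4] show ?case by simp
next
  case 3
  then have "prefix p (T 5)" by simp
  from disc_prefix_T5[OF this] tail_bound_4 tail_bound_Suc_le[of 4] tail_bound_Suc_le[of 5]
  show ?case by simp
next
  case (4 n)
  have IH: "prefix u (T (n + 5)) \<Longrightarrow> \<bar>disc u - 2 / 5\<bar> \<le> 41 / 20 - tail_bound (n + 6)"
    "prefix u (T (n + 4)) \<Longrightarrow> \<bar>disc u - 2 / 5\<bar> \<le> 41 / 20 - tail_bound (n + 5)"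
    "prefix u (T (n + 3)) \<Longrightarrow> \<bar>disc u - 2 / 5\<bar> \<le> 41 / 20 - tail_bound (n + 4)" for u
    using "4.IH"[of u] by (simp_all add: numeral_eq_Suc del: T.simps)
  have bounds: "tail_bound (n + 5) \<le> tail_bound (n + 4)"
    "tail_bound (n + 6) + \<bar>disc (T (n + 5))\<bar> \<le> tail_bound (n + 5)"
    "tail_bound (n + 5) + \<bar>disc (T (n + 4))\<bar> \<le> tail_bound (n + 4)"
    "tail_bound (n + 7) \<le> tail_bound (n + 6)"
    using tail_bound_Suc_le[of "n + 4"] tail_bound_Suc_le[of "n + 6"]
      tail_bound_Suc[of "n + 4"] tail_bound_Suc[of "n + 5"]
    by (simp_all add: numeral_eq_Suc del: T.simps)
  have "T (Suc (Suc (Suc n)) + 3) = T (n + 5) @ T (n + 4) @ T (n + 3)"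
    by (simp add: numeral_eq_Suc)
  with "4.prems" consider "prefix p (T (n + 5))"
    | u where "p = T (n + 5) @ u" "prefix u (T (n + 4))"
    | u where "p = T (n + 5) @ T (n + 4) @ u" "prefix u (T (n + 3))"
    by (auto simp: prefix_append)
  \<comment> \<open>Each shift by a \<open>disc (T k)\<close> is paid for by the drop from
    \<open>tail_bound k\<close> to \<open>tail_bound (k + 1)\<close>.\<close>
  then have "\<bar>disc p - 2 / 5\<bar> \<le> 41 / 20 - tail_bound (n + 7)"
  proof cases
    case 1
    then show ?thesis using IH(1)[of p] bounds by linarith
  next
    case (2 u)
    show ?thesis using IH(2)[OF 2(2)] bounds unfolding 2(1) disc_append by linarith
  next
    case (3 u)
    show ?thesis using IH(3)[OF 3(2)] bounds unfolding 3(1) disc_append by linarith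
  qed
  then show ?case by (simp add: numeral_eq_Suc del: T.simps)
qed

lemma disc_stake_B_inf:
  assumes "1 \<le> p"
  shows "- 5 / 2 < disc (stake p B_inf)" "disc (stake p B_inf) < 33 / 20"
proof -
  obtain u n where u: "stake p B_inf = Zero # u" "prefix u (T (n + 3))"
    using stake_B_inf_prefix[of "p - 1"] assms by auto
  have "\<bar>disc u - 2 / 5\<bar> \<le> 41 / 20"
    using disc_prefix_T[OF u(2)] tail_bound_nonneg[of "n + 4"] by linarith
  then show "- 5 / 2 < disc (stake p B_inf)" "disc (stake p B_inf) < 33 / 20"
    using psi_gt psi_lt unfolding u(1) disc_Zero by linarith+
qed

theorem theorem4:
  fixes n :: nat
  assumes "n \<ge> 1"
  shows "(\<lfloor>psi * real n\<rfloor> - 2 \<le> int (I0 n) \<and> int (I0 n) \<le> \<lfloor>psi * real n\<rfloor> + 2) \<and>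
    (\<lfloor>gamma * real n\<rfloor> - 1 \<le> int (I1 n) \<and> int (I1 n) \<le> \<lfloor>gamma * real n\<rfloor> + 3)"
proof -
  have "disc (stake (I0 n) B_inf) = real (I0 n) - psi * real n"
    using count_stake_occ_pos[OF assms, of Zero] by (simp add: disc_eq_count)
  then have "\<lfloor>psi * real n\<rfloor> - 2 \<le> int (I0 n) \<and> int (I0 n) \<le> \<lfloor>psi * real n\<rfloor> + 2"
    using disc_stake_B_inf[OF occ_pos_pos, of Zero n] by linarith
  moreover have "\<lfloor>gamma * real n\<rfloor> - 1 \<le> int (I1 n) \<and> int (I1 n) \<le> \<lfloor>gamma * real n\<rfloor> + 3"
  proof -
    let ?p = "I1 n"
    have "real ?p = real (count_list (stake ?p B_inf) Zero) + real n"
      using length_eq_count[of "stake ?p B_inf"] count_stake_occ_pos[OF assms, of One] by simp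
    then have "real ?p * (psi - 1) - psi * real n = - disc (stake ?p B_inf)"
      by (simp add: disc_eq_count algebra_simps)
    moreover have "(real ?p - gamma * real n) * (psi - 1) = real ?p * (psi - 1) - gamma * (psi - 1) * real n"
      by (simp add: algebra_simps)
    ultimately have eq: "(real ?p - gamma * real n) * (psi - 1) = - disc (stake ?p B_inf)"
      by (simp only: gamma_eq)
    note bounds = disc_stake_B_inf[OF occ_pos_pos, of One n] psi_gt
    \<comment> \<open>This is where 33 / 20 and 5 / 2 are nearly sharp: \<open>2 * (psi - 1)\<close>
      is about 1.679 and \<open>3 * (psi - 1)\<close> about 2.518.\<close>
    have "(-2) * (psi - 1) < (real ?p - gamma * real n) * (psi - 1)"
      "(real ?p - gamma * real n) * (psi - 1) < 3 * (psi - 1)"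
      unfolding eq using bounds by auto
    then have "-2 < real ?p - gamma * real n" "real ?p - gamma * real n < 3"
      using psi_gt by (auto simp only: mult_less_cancel_right)
    then show ?thesis by linarith
  qed
  ultimately show ?thesis by blast
qed

end
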